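(* Let $(\mathcal{L},[\cdot,\cdot],\alpha,1_\star)$ be a unital (i.e. with a left or right unity $1_\star$) hom-Leibniz algebra that is also hom-associative. The following statements hold: 1) If $\mathcal{L}$ is right hom-Leibniz and $1_\star$ is a left unity, then $\alpha(1_\star)\in Ann_{\mathcal{L}}^r(\mathcal{L})$. 2) If $\mathcal{L}$ is left hom-Leibniz and $1_\star$ is a right unity, then $\alpha(1_\star)\in Ann_{\mathcal{L}}^l(\mathcal{L})$. 3) If $\mathcal{L}$ is right (respectively left) hom-Leibniz and $1_\star$ is a right (respectively left) unity, then $\alpha=0$. 4) A left-unital (respectively right-unital) hom-algebra $(\mathcal{L},[\cdot,\cdot],\alpha)$ with $\alpha\neq 0$ cannot be right hom-Leibniz (respectively left hom-Leibniz) and hom-associative simultaneously.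
   Context: A hom-algebra $(\mathcal{L},[\cdot,\cdot],\alpha)$ is a linear space over a field $\mathbb{F}$ with a bilinear product $[\cdot,\cdot]$ (not assumed skew-symmetric) and a linear map $\alpha\colon\mathcal{L}\to\mathcal{L}$. It is hom-associative if $[\alpha(x),[y,z]]=[[x,y],\alpha(z)]$ for all $x,y,z$. It is left hom-Leibniz if $[\alpha(x),[y,z]]=[[x,y],\alpha(z)]+[\alpha(y),[x,z]]$ for all $x,y,z$, and right hom-Leibniz if $[[x,y],\alpha(z)]=[[x,z],\alpha(y)]+[\alpha(x),[y,z]]$ for all $x,y,z$. A left (right) unity is an element $1_\star$ with $[1_\star,x]=x$ (respectively $[x,1_\star]=x$) for all $x$; a hom-algebra with one is called left-unital (right-unital). $Ann_{\mathcal{L}}^l(\mathcal{L})=\{a\mid [a,x]=0\ \forall x\in\mathcal{L}\}$ and $Ann_{\mathcal{L}}^r(\mathcal{L})=\{a\mid [x,a]=0\ \forall x\in\mathcal{L}\}$. *)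

theory Defs
  imports Complex_Main
begin

text \<open>The underlying linear space is the whole type \<open>'v\<close>, over an arbitrary field \<open>'f\<close>.\<close>

locale hom_algebra = vector_space scale
  for scale :: "'f::field \<Rightarrow> 'v::ab_group_add \<Rightarrow> 'v" +
  fixes bracket :: "'v \<Rightarrow> 'v \<Rightarrow> 'v"
    and \<alpha> :: "'v \<Rightarrow> 'v"
  assumes linear_bracket_left: "\<And>y. Vector_Spaces.linear scale scale (\<lambda>x. bracket x y)"
    and linear_bracket_right: "\<And>x. Vector_Spaces.linear scale scale (\<lambda>y. bracket x y)"
    and linear_twist: "Vector_Spaces.linear scale scale \<alpha>"

definition hom_associative :: "('v \<Rightarrow> 'v \<Rightarrow> 'v) \<Rightarrow> ('v \<Rightarrow> 'v) \<Rightarrow> bool" where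
  "hom_associative br \<alpha> \<longleftrightarrow> (\<forall>x y z. br (\<alpha> x) (br y z) = br (br x y) (\<alpha> z))"

definition left_hom_Leibniz ::
    "('v::ab_group_add \<Rightarrow> 'v \<Rightarrow> 'v) \<Rightarrow> ('v \<Rightarrow> 'v) \<Rightarrow> bool" where
  "left_hom_Leibniz br \<alpha> \<longleftrightarrow>
     (\<forall>x y z. br (\<alpha> x) (br y z) = br (br x y) (\<alpha> z) + br (\<alpha> y) (br x z))"

definition right_hom_Leibniz ::
    "('v::ab_group_add \<Rightarrow> 'v \<Rightarrow> 'v) \<Rightarrow> ('v \<Rightarrow> 'v) \<Rightarrow> bool" where
  "right_hom_Leibniz br \<alpha> \<longleftrightarrow>
     (\<forall>x y z. br (br x y) (\<alpha> z) = br (br x z) (\<alpha> y) + br (\<alpha> x) (br y z))"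

definition left_unity :: "('v \<Rightarrow> 'v \<Rightarrow> 'v) \<Rightarrow> 'v \<Rightarrow> bool" where
  "left_unity br e \<longleftrightarrow> (\<forall>x. br e x = x)"

definition right_unity :: "('v \<Rightarrow> 'v \<Rightarrow> 'v) \<Rightarrow> 'v \<Rightarrow> bool" where
  "right_unity br e \<longleftrightarrow> (\<forall>x. br x e = x)"

definition left_unital :: "('v \<Rightarrow> 'v \<Rightarrow> 'v) \<Rightarrow> bool" where
  "left_unital br \<longleftrightarrow> (\<exists>e. left_unity br e)"

definition right_unital :: "('v \<Rightarrow> 'v \<Rightarrow> 'v) \<Rightarrow> bool" where
  "right_unital br \<longleftrightarrow> (\<exists>e. right_unity br e)"

definition left_annihilator :: "('v::zero \<Rightarrow> 'v \<Rightarrow> 'v) \<Rightarrow> 'v set" where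
  "left_annihilator br = {a. \<forall>x. br a x = 0}"

definition right_annihilator :: "('v::zero \<Rightarrow> 'v \<Rightarrow> 'v) \<Rightarrow> 'v set" where
  "right_annihilator br = {a. \<forall>x. br x a = 0}"

end

theory Submission
  imports Defs
begin

text \<open>
  In a hom-associative algebra the products \<open>[\<alpha>(x), [y, z]]\<close> and \<open>[[x, y], \<alpha>(z)]\<close> coincide, so
  they cancel in either hom-Leibniz identity and the remaining term has to vanish. That term is
  again a triple product with one twisted factor, with its arguments permuted; hence, by
  hom-associativity once more, both bracketings vanish identically. This is the content of
  \<open>right_hom_Leibniz_triple_zero\<close> and \<open>left_hom_Leibniz_triple_zero\<close>.

  A one-sided unity \<open>e\<close> then collapses the triple products: \<open>e = [e, e]\<close>, so a left unity gives
  \<open>\<alpha>(z) = [[e, e], \<alpha>(z)] = 0\<close> and a right unity gives \<open>\<alpha>(x) = [\<alpha>(x), [e, e]] = 0\<close>. Neither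
  computation depends on which hom-Leibniz identity holds, so the third and fourth statements both
  follow from \<open>twist_zero_if_triple_zero\<close>. The first two come from writing an arbitrary element
  as \<open>x = [e, x]\<close> or \<open>x = [x, e]\<close> in a vanishing triple product.
\<close>

text \<open>
  The surviving term of the identity is \<open>[[x, z], \<alpha>(y)]\<close>, a triple product of the form
  \<open>[[_, _], \<alpha>(_)]\<close>; the other bracketing vanishes because hom-associativity equates the two.
\<close>

lemma right_hom_Leibniz_triple_zero:
  assumes "right_hom_Leibniz br \<alpha>" "hom_associative br \<alpha>"
  shows "br (br x y) (\<alpha> z) = 0" and "br (\<alpha> x) (br y z) = 0"
proof -
  have assoc: "br (\<alpha> a) (br b c) = br (br a b) (\<alpha> c)" for a b c
    using assms(2) unfolding hom_associative_def by blast
  have "br (br x z) (\<alpha> y) = br (br x y) (\<alpha> z) + br (\<alpha> x) (br z y)"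
    using assms(1) unfolding right_hom_Leibniz_def by blast
  then show zero: "br (br x y) (\<alpha> z) = 0"
    by (simp add: assoc)
  show "br (\<alpha> x) (br y z) = 0"
    using zero by (simp add: assoc)
qed

text \<open>
  Here the surviving term is \<open>[\<alpha>(y), [x, z]]\<close>, so it is the bracketing \<open>[\<alpha>(_), [_, _]]\<close> that
  vanishes by cancellation, and the other one by hom-associativity.
\<close>

lemma left_hom_Leibniz_triple_zero:
  assumes "left_hom_Leibniz br \<alpha>" "hom_associative br \<alpha>"
  shows "br (br x y) (\<alpha> z) = 0" and "br (\<alpha> x) (br y z) = 0"
proof -
  have assoc: "br (br a b) (\<alpha> c) = br (\<alpha> a) (br b c)" for a b c
    using assms(2) unfolding hom_associative_def by simp
  have "br (\<alpha> y) (br x z) = br (br y x) (\<alpha> z) + br (\<alpha> x) (br y z)"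
    using assms(1) unfolding left_hom_Leibniz_def by blast
  then show zero: "br (\<alpha> x) (br y z) = 0"
    by (simp add: assoc)
  show "br (br x y) (\<alpha> z) = 0"
    using zero by (simp add: assoc)
qed

text \<open>
  A unity on either side satisfies \<open>e = [e, e]\<close>, which turns \<open>\<alpha>(x)\<close>, multiplied by \<open>e\<close> on the
  side where \<open>e\<close> acts trivially, into a triple product.
\<close>

lemma twist_zero_if_triple_zero:
  assumes unity: "left_unity br e \<or> right_unity br e"
    and zero_l: "\<And>x y z. br (br x y) (\<alpha> z) = 0"
    and zero_r: "\<And>x y z. br (\<alpha> x) (br y z) = 0"
  shows "\<alpha> = (\<lambda>x. 0)"
  using unity
proof
  assume "left_unity br e"
  then have "\<alpha> x = br (br e e) (\<alpha> x)" for x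
    by (simp add: left_unity_def)
  then show ?thesis
    by (simp add: zero_l fun_eq_iff)
next
  assume "right_unity br e"
  then have "\<alpha> x = br (\<alpha> x) (br e e)" for x
    by (simp add: right_unity_def)
  then show ?thesis
    by (simp add: zero_r fun_eq_iff)
qed

lemma twist_zero_if_unital_hom_Leibniz_hom_associative:
  assumes "left_unity br e \<or> right_unity br e"
    and "left_hom_Leibniz br \<alpha> \<or> right_hom_Leibniz br \<alpha>"
    and "hom_associative br \<alpha>"
  shows "\<alpha> = (\<lambda>x. 0)"
  using assms(2)
proof
  assume "left_hom_Leibniz br \<alpha>"
  note zero = left_hom_Leibniz_triple_zero[OF this assms(3)]
  show ?thesis
    by (rule twist_zero_if_triple_zero[where br = br, OF assms(1) zero])
next
  assume "right_hom_Leibniz br \<alpha>"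
  note zero = right_hom_Leibniz_triple_zero[OF this assms(3)]
  show ?thesis
    by (rule twist_zero_if_triple_zero[where br = br, OF assms(1) zero])
qed

lemma twist_left_unity_in_right_annihilator:
  assumes "right_hom_Leibniz br \<alpha>" "hom_associative br \<alpha>" "left_unity br e"
  shows "\<alpha> e \<in> right_annihilator br"
proof -
  have "br x (\<alpha> e) = br (br e x) (\<alpha> e)" for x
    using assms(3) by (simp add: left_unity_def)
  then show ?thesis
    using right_hom_Leibniz_triple_zero(1)[OF assms(1,2)] by (simp add: right_annihilator_def)
qed

lemma twist_right_unity_in_left_annihilator:
  assumes "left_hom_Leibniz br \<alpha>" "hom_associative br \<alpha>" "right_unity br e"
  shows "\<alpha> e \<in> left_annihilator br"
proof -
  have "br (\<alpha> e) x = br (\<alpha> e) (br x e)" for x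
    using assms(3) by (simp add: right_unity_def)
  then show ?thesis
    using left_hom_Leibniz_triple_zero(2)[OF assms(1,2)] by (simp add: left_annihilator_def)
qed

theorem proposition58:
  fixes scale :: "'f::field \<Rightarrow> 'v::ab_group_add \<Rightarrow> 'v"
    and br :: "'v \<Rightarrow> 'v \<Rightarrow> 'v"
    and \<alpha> :: "'v \<Rightarrow> 'v"
  assumes "hom_algebra scale br \<alpha>"
  shows
    "(\<forall>e. (left_unity br e \<or> right_unity br e) \<and>
          (left_hom_Leibniz br \<alpha> \<or> right_hom_Leibniz br \<alpha>) \<and>
          hom_associative br \<alpha> \<longrightarrow>
        (right_hom_Leibniz br \<alpha> \<and> left_unity br e \<longrightarrow> \<alpha> e \<in> right_annihilator br) \<and>
        (left_hom_Leibniz br \<alpha> \<and> right_unity br e \<longrightarrow> \<alpha> e \<in> left_annihilator br) \<and>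
        (right_hom_Leibniz br \<alpha> \<and> right_unity br e \<longrightarrow> \<alpha> = (\<lambda>x. 0)) \<and>
        (left_hom_Leibniz br \<alpha> \<and> left_unity br e \<longrightarrow> \<alpha> = (\<lambda>x. 0))) \<and>
     (left_unital br \<and> \<alpha> \<noteq> (\<lambda>x. 0) \<longrightarrow>
        \<not> (right_hom_Leibniz br \<alpha> \<and> hom_associative br \<alpha>)) \<and>
     (right_unital br \<and> \<alpha> \<noteq> (\<lambda>x. 0) \<longrightarrow>
        \<not> (left_hom_Leibniz br \<alpha> \<and> hom_associative br \<alpha>))"
  unfolding left_unital_def right_unital_def
  using twist_left_unity_in_right_annihilator[of br \<alpha>]
    twist_right_unity_in_left_annihilator[of br \<alpha>]
    twist_zero_if_unital_hom_Leibniz_hom_associative[of br _ \<alpha>]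
  by blast

end
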